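(* Let $D$ be an integral domain and let $K$ be its quotient field. Let $\mathcal{I}(D)^\bullet$ be the set of nonzero ideals of $D$. Then the map $\Psi:\mathrm{Star}(D)\to\mathrm{Mult}(D,K,\mathcal{I}(D)^\bullet)$, $\star\mapsto\star|_{\mathcal{I}(D)^\bullet}$, is an order isomorphism.
   Context: All rings are commutative with unit. For a ring extension $A\subseteq B$, $\mathbf{F}_A(B)$ is the set of $A$-submodules of $B$, ordered by inclusion; for $I\in\mathbf{F}_A(B)$ and $b\in B$, $(I:b):=\{x\in B\mid bx\in I\}$. A closure operation on a partially ordered set is an extensive, order-preserving, idempotent self-map. For $\mathcal{G}\subseteq\mathbf{F}_A(B)$, a multiplicative operation on $(A,B,\mathcal{G})$ is a closure operation $\star:\mathcal{G}\to\mathcal{G}$, $I\mapsto I^\star$, such that $(I:b)^\star\subseteq(I^\star:b)$ for all $I\in\mathcal{G}$, $b\in B$ with $(I:b)\in\mathcal{G}$. $\mathrm{Mult}(A,B,\mathcal{G})$ is the set of these, ordered by $\star_1\leq\star_2$ iff $I^{\star_1}\subseteq I^{\star_2}$ for all $I\in\mathcal{G}$. A fractional ideal of $D$ is a $D$-submodule $I$ of $K$ with $dI\subseteq D$ for some $d\in D\setminus\{0\}$; $\mathcal{F}(D)$ is the set of all of them. A star operation on $D$ is a closure operation $\star$ on $(\mathcal{F}(D),\subseteq)$ with $x\cdot I^\star=(xI)^\star$ for all $x\in K$, $I\in\mathcal{F}(D)$, and $D^\star=D$. $\mathrm{Star}(D)$ is the set of star operations, ordered pointwise by inclusion. *)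

theory Defs
  imports "HOL-Algebra.Algebra"
begin

subsection \<open>Posets of sets and closure operations\<close>

definition inclusion_poset :: "'a set set \<Rightarrow> 'a set gorder"
  where "inclusion_poset G = \<lparr>carrier = G, eq = (=), le = (\<subseteq>)\<rparr>"

definition closure_operation :: "('a, 'b) gorder_scheme \<Rightarrow> ('a \<Rightarrow> 'a) \<Rightarrow> bool"
  where "closure_operation L f \<longleftrightarrow>
    f \<in> carrier L \<rightarrow> carrier L \<and>
    (\<forall>x \<in> carrier L. x \<sqsubseteq>\<^bsub>L\<^esub> f x) \<and>
    isotone L L f \<and>
    idempotent L f"

definition order_isomorphism ::
    "('a, 'c) gorder_scheme \<Rightarrow> ('b, 'd) gorder_scheme \<Rightarrow> ('a \<Rightarrow> 'b) \<Rightarrow> bool"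
  where "order_isomorphism L M f \<longleftrightarrow>
    bij_betw f (carrier L) (carrier M) \<and> order_emb L M f"

text \<open>Maps \<open>G \<Rightarrow> G\<close> are represented by functions that are \<open>undefined\<close> outside \<open>G\<close>, so that
  equality in HOL is equality of maps on \<open>G\<close>.\<close>

definition operation_poset :: "'a set set \<Rightarrow> (('a set \<Rightarrow> 'a set) \<Rightarrow> bool) \<Rightarrow> ('a set \<Rightarrow> 'a set) gorder"
  where "operation_poset G P =
    \<lparr>carrier = {s \<in> G \<rightarrow>\<^sub>E G. P s}, eq = (=), le = (\<lambda>s t. \<forall>I\<in>G. s I \<subseteq> t I)\<rparr>"


subsection \<open>Multiplicative operations on a ring extension\<close>

text \<open>The ring \<open>B\<close> with its multiplication as scalar multiplication; as a module over a subring
  \<open>A\<close>, its submodules are the \<open>A\<close>-submodules of \<open>B\<close>.\<close>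

definition self_module :: "('a, 'm) ring_scheme \<Rightarrow> ('a, 'a) module"
  where "self_module B =
    \<lparr>carrier = carrier B, monoid.mult = (\<otimes>\<^bsub>B\<^esub>), one = \<one>\<^bsub>B\<^esub>, ring.zero = \<zero>\<^bsub>B\<^esub>, ring.add = (\<oplus>\<^bsub>B\<^esub>),
      smult = (\<otimes>\<^bsub>B\<^esub>)\<rparr>"

definition submodules_of :: "'a set \<Rightarrow> ('a, 'm) ring_scheme \<Rightarrow> 'a set set"
  where "submodules_of A B = {I. submodule I (B\<lparr>carrier := A\<rparr>) (self_module B)}"

definition colon :: "('a, 'm) ring_scheme \<Rightarrow> 'a set \<Rightarrow> 'a \<Rightarrow> 'a set"
  where "colon B I b = {x \<in> carrier B. b \<otimes>\<^bsub>B\<^esub> x \<in> I}"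

definition multiplicative_operation ::
    "'a set \<Rightarrow> ('a, 'm) ring_scheme \<Rightarrow> 'a set set \<Rightarrow> ('a set \<Rightarrow> 'a set) \<Rightarrow> bool"
  where "multiplicative_operation A B G s \<longleftrightarrow>
    G \<subseteq> submodules_of A B \<and>
    closure_operation (inclusion_poset G) s \<and>
    (\<forall>I\<in>G. \<forall>b\<in>carrier B. colon B I b \<in> G \<longrightarrow> s (colon B I b) \<subseteq> colon B (s I) b)"

definition Mult :: "'a set \<Rightarrow> ('a, 'm) ring_scheme \<Rightarrow> 'a set set \<Rightarrow> ('a set \<Rightarrow> 'a set) gorder"
  where "Mult A B G = operation_poset G (multiplicative_operation A B G)"


subsection \<open>Star operations on an integral domain\<close>

locale quotient_field = field K + subdomain D K for D and K (structure) +
  assumes fraction: "x \<in> carrier K \<Longrightarrow> \<exists>a\<in>D. \<exists>b\<in>D - {\<zero>}. x = a \<otimes> inv b"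

definition nonzero_ideals :: "'a set \<Rightarrow> ('a, 'm) ring_scheme \<Rightarrow> 'a set set"
  where "nonzero_ideals D K = {I. ideal I (K\<lparr>carrier := D\<rparr>) \<and> I \<noteq> {\<zero>\<^bsub>K\<^esub>}}"

definition fractional_ideals :: "'a set \<Rightarrow> ('a, 'm) ring_scheme \<Rightarrow> 'a set set"
  where "fractional_ideals D K =
    {I \<in> submodules_of D K. \<exists>d\<in>D - {\<zero>\<^bsub>K\<^esub>}. d <#\<^bsub>K\<^esub> I \<subseteq> D}"

definition star_operation :: "'a set \<Rightarrow> ('a, 'm) ring_scheme \<Rightarrow> ('a set \<Rightarrow> 'a set) \<Rightarrow> bool"
  where "star_operation D K s \<longleftrightarrow>
    closure_operation (inclusion_poset (fractional_ideals D K)) s \<and>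
    (\<forall>x\<in>carrier K. \<forall>I\<in>fractional_ideals D K. x <#\<^bsub>K\<^esub> s I = s (x <#\<^bsub>K\<^esub> I)) \<and>
    s D = D"

definition Star :: "'a set \<Rightarrow> ('a, 'm) ring_scheme \<Rightarrow> ('a set \<Rightarrow> 'a set) gorder"
  where "Star D K = operation_poset (fractional_ideals D K) (star_operation D K)"

end

theory Submission
  imports Defs
begin

text \<open>
  A nonzero fractional ideal \<open>I\<close> is a multiple \<open>d\<^sup>-\<^sup>1 (d I)\<close> of the nonzero ideal \<open>d I\<close>, where
  \<open>d\<close> is any common denominator. A star operation commutes with multiplication by \<open>d\<close>, so
  its value \<open>I\<^sup>\<star> = d\<^sup>-\<^sup>1 (d I)\<^sup>\<star>\<close> is dictated by its restriction to the nonzero ideals; this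
  gives the order embedding.

  For surjectivity one reads \<open>I\<^sup>\<star> = d\<^sup>-\<^sup>1 (d I)\<^sup>\<star>\<close> as a definition. What has to be shown is that
  a multiplicative operation on the nonzero ideals already commutes with multiplication by
  every \<open>b \<noteq> 0\<close> that carries a nonzero ideal \<open>I\<close> to an ideal: this makes the definition
  independent of \<open>d\<close>. Now \<open>b I = (I : b\<^sup>-\<^sup>1)\<close>, so the defining inclusion of multiplicative operations
  reads \<open>(b I)\<^sup>\<star> \<subseteq> b I\<^sup>\<star>\<close>; the same inclusion for the ideal \<open>b I\<close> and the factor \<open>b\<^sup>-\<^sup>1\<close>
  is \<open>I\<^sup>\<star> \<subseteq> b\<^sup>-\<^sup>1 (b I)\<^sup>\<star>\<close>, which is the other half (lemma \<open>multiplicative_operation_scale\<close>).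
  All axioms of a star operation are then checked after clearing denominators. Finally,
  \<open>D\<^sup>\<star> = D\<close> holds because \<open>D\<close> is the largest element on which the multiplicative operation acts.

  The zero ideal is a fractional ideal as well, but homogeneity for the factor \<open>0\<close>
  forces every star operation to fix it.
\<close>

section \<open>Posets of operations\<close>

lemma weak_partial_order_inclusion_poset: "weak_partial_order (inclusion_poset G)"
  by unfold_locales (auto simp: inclusion_poset_def)

lemma closure_operation_inclusion_poset_iff:
  "closure_operation (inclusion_poset G) f \<longleftrightarrow>
    f \<in> G \<rightarrow> G \<and> (\<forall>I\<in>G. I \<subseteq> f I) \<and> (\<forall>I\<in>G. \<forall>J\<in>G. I \<subseteq> J \<longrightarrow> f I \<subseteq> f J) \<and>
    (\<forall>I\<in>G. f (f I) = f I)"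
  using weak_partial_order_inclusion_poset[of G]
  by (simp add: closure_operation_def isotone_def idempotent_def inclusion_poset_def)

lemma operation_poset_antisym:
  assumes "s \<in> carrier (operation_poset G P)" "t \<in> carrier (operation_poset G P)"
    and "\<And>I. I \<in> G \<Longrightarrow> s I \<subseteq> t I" "\<And>I. I \<in> G \<Longrightarrow> t I \<subseteq> s I"
  shows "s = t"
  using assms by (auto simp: operation_poset_def intro!: PiE_ext[of s G "\<lambda>_. G"])

lemma weak_partial_order_operation_poset: "weak_partial_order (operation_poset G P)"
proof unfold_locales
  fix s t
  assume "s \<sqsubseteq>\<^bsub>operation_poset G P\<^esub> t" "t \<sqsubseteq>\<^bsub>operation_poset G P\<^esub> s"
    "s \<in> carrier (operation_poset G P)" "t \<in> carrier (operation_poset G P)"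
  then show "s .=\<^bsub>operation_poset G P\<^esub> t"
    using operation_poset_antisym[of s G P t] by (auto simp: operation_poset_def)
qed (auto simp: operation_poset_def)

lemma order_isomorphism_operation_posetI:
  assumes into: "\<And>s. s \<in> carrier (operation_poset G P) \<Longrightarrow> f s \<in> carrier (operation_poset H Q)"
    and emb: "\<And>s t. \<lbrakk>s \<in> carrier (operation_poset G P); t \<in> carrier (operation_poset G P)\<rbrakk> \<Longrightarrow>
      (\<forall>I\<in>H. f s I \<subseteq> f t I) \<longleftrightarrow> (\<forall>I\<in>G. s I \<subseteq> t I)"
    and onto: "\<And>t. t \<in> carrier (operation_poset H Q) \<Longrightarrow>
      \<exists>s\<in>carrier (operation_poset G P). f s = t"
  shows "order_isomorphism (operation_poset G P) (operation_poset H Q) f"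
proof -
  have "inj_on f (carrier (operation_poset G P))"
  proof (rule inj_onI)
    fix s t
    assume s: "s \<in> carrier (operation_poset G P)" and t: "t \<in> carrier (operation_poset G P)"
      and eq: "f s = f t"
    have "\<forall>I\<in>G. s I \<subseteq> t I" "\<forall>I\<in>G. t I \<subseteq> s I"
      using emb[OF s t] emb[OF t s] eq by auto
    then show "s = t"
      using operation_poset_antisym[OF s t] by blast
  qed
  moreover have "f ` carrier (operation_poset G P) = carrier (operation_poset H Q)"
    using into onto by blast
  moreover have "order_emb (operation_poset G P) (operation_poset H Q) f"
    using emb by (simp add: order_emb_def weak_partial_order_operation_poset)
      (simp add: operation_poset_def)
  ultimately show ?thesis
    by (simp add: order_isomorphism_def bij_betw_def)
qed


section \<open>Multiples of submodules\<close>

lemma l_coset_eq_image: "x <#\<^bsub>G\<^esub> I = (\<lambda>h. x \<otimes>\<^bsub>G\<^esub> h) ` I"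
  by (auto simp: l_coset_def)

lemma l_coset_mono: "I \<subseteq> J \<Longrightarrow> x <#\<^bsub>G\<^esub> I \<subseteq> x <#\<^bsub>G\<^esub> J"
  by (auto simp: l_coset_def)

lemma (in monoid) l_coset_l_coset:
  "\<lbrakk>x \<in> carrier G; y \<in> carrier G; I \<subseteq> carrier G\<rbrakk> \<Longrightarrow> x <#\<^bsub>G\<^esub> (y <#\<^bsub>G\<^esub> I) = (x \<otimes> y) <#\<^bsub>G\<^esub> I"
  by (auto simp: l_coset_eq_image image_image m_assoc subset_iff intro!: image_cong)

lemma (in monoid) one_l_coset: "I \<subseteq> carrier G \<Longrightarrow> \<one> <#\<^bsub>G\<^esub> I = I"
  by (force simp: l_coset_eq_image)

lemma submodules_of_iff:
  "I \<in> submodules_of A B \<longleftrightarrow>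
    subgroup I (add_monoid B) \<and> (\<forall>a\<in>A. \<forall>x\<in>I. a \<otimes>\<^bsub>B\<^esub> x \<in> I)"
  by (auto simp: submodules_of_def submodule_def submodule_axioms_def self_module_def
      subgroup_def m_inv_def)

context quotient_field
begin

abbreviation multiple :: "'a \<Rightarrow> 'a set \<Rightarrow> 'a set"  (infixr \<open>\<bullet>\<close> 75)
  where "x \<bullet> I \<equiv> x <#\<^bsub>K\<^esub> I"

lemma D_carrier: "D \<subseteq> carrier K"
  using subset by auto

lemma one_mem_D: "\<one> \<in> D"
  by (rule submonoid.one_closed) (rule submonoid_axioms)

lemma mult_mem_D: "\<lbrakk>a \<in> D; b \<in> D\<rbrakk> \<Longrightarrow> a \<otimes> b \<in> D"
  by (rule submonoid.m_closed) (rule submonoid_axioms)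

lemma nonzero_inv:
  assumes "x \<in> carrier K - {\<zero>}"
  shows "inv x \<in> carrier K - {\<zero>}" "x \<otimes> inv x = \<one>" "inv x \<otimes> x = \<one>"
proof -
  have "x \<in> Units K"
    using assms field_Units by blast
  then show "inv x \<in> carrier K - {\<zero>}" "x \<otimes> inv x = \<one>" "inv x \<otimes> x = \<one>"
    using Units_inv_Units[of x] field_Units by auto
qed

lemma nonzero_mult: "\<lbrakk>x \<in> carrier K - {\<zero>}; y \<in> carrier K - {\<zero>}\<rbrakk> \<Longrightarrow> x \<otimes> y \<in> carrier K - {\<zero>}"
  by (simp add: integral_iff)

lemma submodule_carrier: "I \<in> submodules_of D K \<Longrightarrow> I \<subseteq> carrier K"
  using subgroup.subset[of I "add_monoid K"] by (auto simp: submodules_of_iff)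

lemma submodule_zero: "I \<in> submodules_of D K \<Longrightarrow> \<zero> \<in> I"
  using subgroup.one_closed[of I "add_monoid K"] by (simp add: submodules_of_iff)

lemma inv_l_coset_l_coset:
  assumes "b \<in> carrier K - {\<zero>}" "I \<subseteq> carrier K"
  shows "inv b \<bullet> (b \<bullet> I) = I" "b \<bullet> (inv b \<bullet> I) = I"
  using assms nonzero_inv[OF assms(1)] by (simp_all add: l_coset_l_coset one_l_coset)

lemma submodule_l_coset:
  assumes x: "x \<in> carrier K" and I: "I \<in> submodules_of D K"
  shows "x \<bullet> I \<in> submodules_of D K"
proof -
  note sub = I[unfolded submodules_of_iff, THEN conjunct1]
  note car = submodule_carrier[OF I]
  have "subgroup (x \<bullet> I) (add_monoid K)"
  proof (rule add.subgroupI)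
    show "x \<bullet> I \<subseteq> carrier K"
      using x car by (auto simp: l_coset_eq_image)
    show "x \<bullet> I \<noteq> {}"
      using submodule_zero[OF I] by (auto simp: l_coset_eq_image)
    show "\<ominus> a \<in> x \<bullet> I" if "a \<in> x \<bullet> I" for a
    proof -
      obtain h where h: "h \<in> I" "a = x \<otimes> h"
        using \<open>a \<in> x \<bullet> I\<close> by (auto simp: l_coset_eq_image)
      then have "\<ominus> h \<in> I" "\<ominus> a = x \<otimes> (\<ominus> h)"
        using subgroup.m_inv_closed[OF sub] x car by (auto simp: a_inv_def[symmetric] r_minus)
      then show ?thesis
        by (auto simp: l_coset_eq_image)
    qed
    show "a \<oplus> b \<in> x \<bullet> I" if ab: "a \<in> x \<bullet> I" "b \<in> x \<bullet> I" for a b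
    proof -
      obtain h k where hk: "h \<in> I" "a = x \<otimes> h" "k \<in> I" "b = x \<otimes> k"
        using ab by (auto simp: l_coset_eq_image)
      then have "h \<oplus> k \<in> I" "a \<oplus> b = x \<otimes> (h \<oplus> k)"
        using subgroup.m_closed[OF sub] x subsetD[OF car] by (simp_all add: r_distr)
      then show ?thesis
        by (auto simp: l_coset_eq_image)
    qed
  qed
  moreover have "a \<otimes> y \<in> x \<bullet> I" if "a \<in> D" "y \<in> x \<bullet> I" for a y
  proof -
    obtain h where h: "h \<in> I" "y = x \<otimes> h"
      using \<open>y \<in> x \<bullet> I\<close> by (auto simp: l_coset_eq_image)
    then have "a \<otimes> h \<in> I" "a \<otimes> y = x \<otimes> (a \<otimes> h)"
      using I \<open>a \<in> D\<close> D_carrier x car by (auto simp: submodules_of_iff intro!: m_lcomm)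
    then show ?thesis
      by (auto simp: l_coset_eq_image)
  qed
  ultimately show ?thesis
    by (simp add: submodules_of_iff)
qed

lemma zero_l_coset: "I \<in> submodules_of D K \<Longrightarrow> \<zero> \<bullet> I = {\<zero>}"
  using submodule_carrier[of I] submodule_zero[of I] by (force simp: l_coset_eq_image)

lemma l_coset_zero: "x \<in> carrier K \<Longrightarrow> x \<bullet> {\<zero>} = {\<zero>}"
  by (simp add: l_coset_eq_image)

lemma l_coset_eq_zero_iff:
  assumes "b \<in> carrier K - {\<zero>}" "I \<subseteq> carrier K"
  shows "b \<bullet> I = {\<zero>} \<longleftrightarrow> I = {\<zero>}"
  using assms inv_l_coset_l_coset(1)[OF assms] nonzero_inv(1)[OF assms(1)] l_coset_zero by auto

lemma colon_eq_l_coset: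
  assumes b: "b \<in> carrier K - {\<zero>}" and I: "I \<subseteq> carrier K"
  shows "colon K I b = inv b \<bullet> I"
proof
  show "colon K I b \<subseteq> inv b \<bullet> I"
  proof
    fix x
    assume "x \<in> colon K I b"
    then have "x \<in> carrier K" "b \<otimes> x \<in> I"
      by (auto simp: colon_def)
    moreover from this have "x = inv b \<otimes> (b \<otimes> x)"
      using b nonzero_inv[OF b] by (simp add: m_assoc[symmetric])
    ultimately show "x \<in> inv b \<bullet> I"
      by (auto simp: l_coset_eq_image)
  qed
next
  show "inv b \<bullet> I \<subseteq> colon K I b"
    using b I nonzero_inv[OF b] by (auto simp: l_coset_eq_image colon_def m_assoc[symmetric] subset_iff)
qed


section \<open>Nonzero ideals and fractional ideals\<close>

lemma nonzero_ideals_iff: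
  "I \<in> nonzero_ideals D K \<longleftrightarrow> I \<in> submodules_of D K \<and> I \<subseteq> D \<and> I \<noteq> {\<zero>}"
proof -
  have D: "subgroup D (add_monoid K)"
    by (rule subgroup_axioms)
  have ring: "ring (K\<lparr>carrier := D\<rparr>)"
    by (rule subring_is_ring) (rule subring_axioms)
  have "ideal I (K\<lparr>carrier := D\<rparr>) \<longleftrightarrow> I \<in> submodules_of D K \<and> I \<subseteq> D"
  proof
    assume "ideal I (K\<lparr>carrier := D\<rparr>)"
    then interpret I: ideal I "K\<lparr>carrier := D\<rparr>" .
    have "subgroup I ((add_monoid K)\<lparr>carrier := D\<rparr>)"
      using I.a_subgroup by simp
    then have "subgroup I (add_monoid K)"
      by (rule add.incl_subgroup[OF D])
    then show "I \<in> submodules_of D K \<and> I \<subseteq> D"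
      using I.I_l_closed I.a_subset by (auto simp: submodules_of_iff)
  next
    assume I: "I \<in> submodules_of D K \<and> I \<subseteq> D"
    show "ideal I (K\<lparr>carrier := D\<rparr>)"
    proof (rule idealI[OF ring])
      show "subgroup I (add_monoid (K\<lparr>carrier := D\<rparr>))"
        using add.subgroup_incl[of I D] I D by (simp add: submodules_of_iff)
      show "x \<otimes>\<^bsub>K\<lparr>carrier := D\<rparr>\<^esub> a \<in> I"
        if "a \<in> I" "x \<in> carrier (K\<lparr>carrier := D\<rparr>)" for a x
        using that I by (simp add: submodules_of_iff)
      then show "a \<otimes>\<^bsub>K\<lparr>carrier := D\<rparr>\<^esub> x \<in> I"
        if "a \<in> I" "x \<in> carrier (K\<lparr>carrier := D\<rparr>)" for a x
        using that I D_carrier m_comm[of a x] by auto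
    qed
  qed
  then show ?thesis
    by (auto simp: nonzero_ideals_def)
qed

lemma D_nonzero_ideal: "D \<in> nonzero_ideals D K"
proof -
  have "D \<noteq> {\<zero>}"
    using one_mem_D sub_one_not_zero by blast
  then show ?thesis
    using subgroup_axioms mult_mem_D by (simp add: nonzero_ideals_iff submodules_of_iff)
qed

lemma nonzero_ideal_carrier: "I \<in> nonzero_ideals D K \<Longrightarrow> I \<subseteq> carrier K"
  using D_carrier by (auto simp: nonzero_ideals_iff)

lemma nonzero_ideal_fractional: "I \<in> nonzero_ideals D K \<Longrightarrow> I \<in> fractional_ideals D K"
  using one_l_coset[of I] nonzero_ideal_carrier[of I] one_mem_D sub_one_not_zero
  by (auto simp: fractional_ideals_def nonzero_ideals_iff intro!: bexI[of _ \<one>])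

lemma fractional_submodule: "I \<in> fractional_ideals D K \<Longrightarrow> I \<in> submodules_of D K"
  by (simp add: fractional_ideals_def)

lemma fractional_carrier: "I \<in> fractional_ideals D K \<Longrightarrow> I \<subseteq> carrier K"
  by (simp add: fractional_submodule submodule_carrier)

lemma fractional_denominator:
  assumes "I \<in> fractional_ideals D K"
  obtains d where "d \<in> carrier K - {\<zero>}" "d \<bullet> I \<subseteq> D"
  using assms D_carrier by (auto simp: fractional_ideals_def)

lemma zero_fractional: "{\<zero>} \<in> fractional_ideals D K"
proof -
  have "{\<zero>} = \<zero> \<bullet> D"
    using zero_l_coset[of D] D_nonzero_ideal by (simp add: nonzero_ideals_iff)
  then have "{\<zero>} \<in> submodules_of D K"
    using submodule_l_coset[of \<zero> D] D_nonzero_ideal by (simp add: nonzero_ideals_iff)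
  moreover have "\<one> \<bullet> {\<zero>} \<subseteq> D"
    using l_coset_zero D_nonzero_ideal by (auto simp: nonzero_ideals_iff submodule_zero)
  ultimately show ?thesis
    using one_mem_D sub_one_not_zero by (auto simp: fractional_ideals_def)
qed

lemma denominator_nonzero_ideal:
  assumes "I \<in> fractional_ideals D K" "I \<noteq> {\<zero>}" "d \<in> carrier K - {\<zero>}" "d \<bullet> I \<subseteq> D"
  shows "d \<bullet> I \<in> nonzero_ideals D K"
  using assms submodule_l_coset[of d I] l_coset_eq_zero_iff[of d I]
  by (simp add: nonzero_ideals_iff fractional_submodule fractional_carrier)

text \<open>A denominator may be any nonzero element of \<open>K\<close>: writing it as \<open>a / c\<close>, the numerator
  \<open>a\<close> is a denominator in \<open>D\<close>.\<close>

lemma fractionalI: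
  assumes I: "I \<in> submodules_of D K" and b: "b \<in> carrier K - {\<zero>}" and le: "b \<bullet> I \<subseteq> D"
  shows "I \<in> fractional_ideals D K"
proof -
  obtain a c where a: "a \<in> D" and c: "c \<in> D - {\<zero>}" and bac: "b = a \<otimes> inv c"
    using fraction b by blast
  have cK: "c \<in> carrier K - {\<zero>}" and aK: "a \<in> carrier K"
    using a c D_carrier by auto
  have "a = c \<otimes> b"
    using nonzero_inv[OF cK] aK cK m_lcomm[of c a "inv c"] by (simp add: bac)
  then have "a \<bullet> I = c \<bullet> (b \<bullet> I)"
    using b cK submodule_carrier[OF I] by (simp add: l_coset_l_coset)
  also have "\<dots> \<subseteq> D"
    using le c by (auto simp: l_coset_eq_image)
  finally have "a \<bullet> I \<subseteq> D" .
  moreover have "a \<noteq> \<zero>"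
    using b cK nonzero_inv(1)[OF cK] by (auto simp: bac)
  ultimately show ?thesis
    using I a by (auto simp: fractional_ideals_def)
qed

lemma fractional_l_coset:
  assumes x: "x \<in> carrier K" and I: "I \<in> fractional_ideals D K"
  shows "x \<bullet> I \<in> fractional_ideals D K"
proof (cases "x = \<zero>")
  case True
  then show ?thesis
    using zero_fractional zero_l_coset fractional_submodule[OF I] by simp
next
  case False
  then have x': "x \<in> carrier K - {\<zero>}"
    using x by simp
  obtain d where d: "d \<in> carrier K - {\<zero>}" "d \<bullet> I \<subseteq> D"
    by (rule fractional_denominator[OF I])
  have "(d \<otimes> inv x) \<bullet> (x \<bullet> I) = d \<bullet> (inv x \<bullet> (x \<bullet> I))"
    using d nonzero_inv(1)[OF x'] submodule_carrier[OF submodule_l_coset[OF x fractional_submodule[OF I]]]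
    by (simp add: l_coset_l_coset)
  also have "\<dots> \<subseteq> D"
    using d inv_l_coset_l_coset(1)[OF x' fractional_carrier[OF I]] by simp
  finally show ?thesis
    using fractionalI submodule_l_coset[OF x fractional_submodule[OF I]]
      nonzero_mult[OF d(1) nonzero_inv(1)[OF x']] by blast
qed


section \<open>Restriction of star operations\<close>

lemma mem_Star_iff:
  "s \<in> carrier (Star D K) \<longleftrightarrow>
    s \<in> fractional_ideals D K \<rightarrow>\<^sub>E fractional_ideals D K \<and>
    (\<forall>I\<in>fractional_ideals D K. I \<subseteq> s I) \<and>
    (\<forall>I\<in>fractional_ideals D K. \<forall>J\<in>fractional_ideals D K. I \<subseteq> J \<longrightarrow> s I \<subseteq> s J) \<and>
    (\<forall>I\<in>fractional_ideals D K. s (s I) = s I) \<and>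
    (\<forall>x\<in>carrier K. \<forall>I\<in>fractional_ideals D K. x \<bullet> s I = s (x \<bullet> I)) \<and> s D = D"
  by (auto simp: Star_def operation_poset_def star_operation_def
      closure_operation_inclusion_poset_iff)

lemma mem_Mult_iff:
  "t \<in> carrier (Mult D K (nonzero_ideals D K)) \<longleftrightarrow>
    t \<in> nonzero_ideals D K \<rightarrow>\<^sub>E nonzero_ideals D K \<and>
    (\<forall>I\<in>nonzero_ideals D K. I \<subseteq> t I) \<and>
    (\<forall>I\<in>nonzero_ideals D K. \<forall>J\<in>nonzero_ideals D K. I \<subseteq> J \<longrightarrow> t I \<subseteq> t J) \<and>
    (\<forall>I\<in>nonzero_ideals D K. t (t I) = t I) \<and>
    (\<forall>I\<in>nonzero_ideals D K. \<forall>b\<in>carrier K. colon K I b \<in> nonzero_ideals D K \<longrightarrow>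
      t (colon K I b) \<subseteq> colon K (t I) b)"
  by (auto simp: Mult_def operation_poset_def multiplicative_operation_def
      closure_operation_inclusion_poset_iff nonzero_ideals_iff)

lemma Star_mono:
  "\<lbrakk>s \<in> carrier (Star D K); I \<in> fractional_ideals D K; J \<in> fractional_ideals D K; I \<subseteq> J\<rbrakk> \<Longrightarrow>
    s I \<subseteq> s J"
  unfolding mem_Star_iff by blast

lemma Mult_colon:
  "\<lbrakk>t \<in> carrier (Mult D K (nonzero_ideals D K)); I \<in> nonzero_ideals D K; b \<in> carrier K;
    colon K I b \<in> nonzero_ideals D K\<rbrakk> \<Longrightarrow> t (colon K I b) \<subseteq> colon K (t I) b"
  unfolding mem_Mult_iff by blast

lemma star_operation_zero:
  assumes s: "s \<in> carrier (Star D K)"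
  shows "s {\<zero>} = {\<zero>}"
proof -
  have "s {\<zero>} \<in> fractional_ideals D K" "\<zero> \<bullet> s {\<zero>} = s (\<zero> \<bullet> {\<zero>})"
    using s zero_fractional by (auto simp: mem_Star_iff)
  then show ?thesis
    using l_coset_zero zero_l_coset fractional_submodule by simp
qed

lemma star_operation_nonzero_ideal:
  assumes s: "s \<in> carrier (Star D K)" and I: "I \<in> nonzero_ideals D K"
  shows "s I \<in> nonzero_ideals D K"
proof -
  have IF: "I \<in> fractional_ideals D K" and DF: "D \<in> fractional_ideals D K"
    using I D_nonzero_ideal nonzero_ideal_fractional by auto
  have sI: "s I \<in> fractional_ideals D K" "s D = D" "I \<subseteq> s I"
    using s IF by (auto simp: mem_Star_iff)
  have "s I \<subseteq> s D"
    by (rule Star_mono[OF s IF DF]) (use I in \<open>simp add: nonzero_ideals_iff\<close>)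
  moreover have "\<not> I \<subseteq> {\<zero>}"
    using I submodule_zero[of I] by (auto simp: nonzero_ideals_iff subset_singleton_iff)
  then have "s I \<noteq> {\<zero>}"
    using sI(3) by metis
  ultimately show ?thesis
    using sI by (simp add: nonzero_ideals_iff fractional_submodule)
qed

lemma star_operation_restrict:
  assumes s: "s \<in> carrier (Star D K)"
  shows "restrict s (nonzero_ideals D K) \<in> carrier (Mult D K (nonzero_ideals D K))"
proof -
  have "s (colon K I b) \<subseteq> colon K (s I) b"
    if I: "I \<in> nonzero_ideals D K" and b: "b \<in> carrier K"
      and c: "colon K I b \<in> nonzero_ideals D K" for I b
  proof (cases "b = \<zero>")
    \<comment> \<open>\<open>(I : 0) = K\<close> is an ideal of \<open>D\<close> only if \<open>D = K\<close>; the inclusion holds anyway.\<close>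
    case True
    have "\<zero> \<in> s I"
      using star_operation_nonzero_ideal[OF s I] by (simp add: nonzero_ideals_iff submodule_zero)
    then have "colon K (s I) b = carrier K"
      using True by (auto simp: colon_def)
    then show ?thesis
      using nonzero_ideal_carrier[OF star_operation_nonzero_ideal[OF s c]] by simp
  next
    case False
    then have b': "b \<in> carrier K - {\<zero>}"
      using b by simp
    have "s (inv b \<bullet> I) = inv b \<bullet> s I"
      using s nonzero_inv(1)[OF b'] nonzero_ideal_fractional[OF I] by (simp add: mem_Star_iff)
    then show ?thesis
      using colon_eq_l_coset[OF b'] nonzero_ideal_carrier[OF I]
        nonzero_ideal_carrier[OF star_operation_nonzero_ideal[OF s I]] by simp
  qed
  then show ?thesis
    using s star_operation_nonzero_ideal[OF s] nonzero_ideal_fractional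
    by (simp add: mem_Mult_iff mem_Star_iff)
qed

lemma star_operation_clear_denominator:
  assumes s: "s \<in> carrier (Star D K)" and I: "I \<in> fractional_ideals D K"
    and d: "d \<in> carrier K - {\<zero>}"
  shows "s I = inv d \<bullet> s (d \<bullet> I)"
proof -
  have "s I \<in> fractional_ideals D K" "s (d \<bullet> I) = d \<bullet> s I"
    using s I d by (auto simp: mem_Star_iff)
  then show ?thesis
    using inv_l_coset_l_coset(1)[OF d] fractional_carrier by simp
qed

lemma star_operations_le_iff:
  assumes s: "s \<in> carrier (Star D K)" and t: "t \<in> carrier (Star D K)"
  shows "(\<forall>I\<in>nonzero_ideals D K. s I \<subseteq> t I) \<longleftrightarrow> (\<forall>I\<in>fractional_ideals D K. s I \<subseteq> t I)"
proof
  assume le: "\<forall>I\<in>nonzero_ideals D K. s I \<subseteq> t I"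
  show "\<forall>I\<in>fractional_ideals D K. s I \<subseteq> t I"
  proof
    fix I
    assume I: "I \<in> fractional_ideals D K"
    obtain d where d: "d \<in> carrier K - {\<zero>}" "d \<bullet> I \<subseteq> D"
      by (rule fractional_denominator[OF I])
    show "s I \<subseteq> t I"
    proof (cases "I = {\<zero>}")
      case True
      then show ?thesis
        using star_operation_zero[OF s] star_operation_zero[OF t] by simp
    next
      case False
      then have "s (d \<bullet> I) \<subseteq> t (d \<bullet> I)"
        using le denominator_nonzero_ideal[OF I _ d] by blast
      then show ?thesis
        using star_operation_clear_denominator[OF s I d(1)]
          star_operation_clear_denominator[OF t I d(1)] by (simp add: l_coset_mono)
    qed
  qed
qed (simp add: nonzero_ideal_fractional)


section \<open>Extension of multiplicative operations\<close>

lemma multiplicative_operation_scale_subset: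
  assumes t: "t \<in> carrier (Mult D K (nonzero_ideals D K))" and I: "I \<in> nonzero_ideals D K"
    and b: "b \<in> carrier K - {\<zero>}" and bI: "b \<bullet> I \<in> nonzero_ideals D K"
  shows "t (b \<bullet> I) \<subseteq> b \<bullet> t I"
proof -
  have inv_inv: "inv (inv b) = b"
    using b field_Units by simp
  have tI: "t I \<in> nonzero_ideals D K"
    using t I by (auto simp: mem_Mult_iff)
  \<comment> \<open>\<open>b I = (I : b\<^sup>-\<^sup>1)\<close>, and likewise for the closure of \<open>I\<close>.\<close>
  have colon: "colon K J (inv b) = b \<bullet> J" if "J \<in> nonzero_ideals D K" for J
    using colon_eq_l_coset[OF nonzero_inv(1)[OF b] nonzero_ideal_carrier[OF that]] inv_inv by simp
  have "t (colon K I (inv b)) \<subseteq> colon K (t I) (inv b)"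
    by (rule Mult_colon[OF t I]) (use bI nonzero_inv(1)[OF b] colon[OF I] in auto)
  then show ?thesis
    using colon[OF I] colon[OF tI] by simp
qed

text \<open>The inclusion for \<open>(I, b)\<close> and the one for \<open>(b I, b\<^sup>-\<^sup>1)\<close> are the two halves of homogeneity.\<close>

lemma multiplicative_operation_scale:
  assumes t: "t \<in> carrier (Mult D K (nonzero_ideals D K))" and I: "I \<in> nonzero_ideals D K"
    and b: "b \<in> carrier K - {\<zero>}" and bI: "b \<bullet> I \<in> nonzero_ideals D K"
  shows "t (b \<bullet> I) = b \<bullet> t I"
proof
  show "t (b \<bullet> I) \<subseteq> b \<bullet> t I"
    by (rule multiplicative_operation_scale_subset[OF assms])
  have tbI: "t (b \<bullet> I) \<in> nonzero_ideals D K"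
    using t bI by (auto simp: mem_Mult_iff)
  have eq: "inv b \<bullet> (b \<bullet> I) = I"
    by (rule inv_l_coset_l_coset(1)[OF b nonzero_ideal_carrier[OF I]])
  have "t (inv b \<bullet> (b \<bullet> I)) \<subseteq> inv b \<bullet> t (b \<bullet> I)"
    using multiplicative_operation_scale_subset[OF t bI nonzero_inv(1)[OF b]] eq I by simp
  then have "b \<bullet> t I \<subseteq> b \<bullet> (inv b \<bullet> t (b \<bullet> I))"
    unfolding eq by (rule l_coset_mono)
  then show "b \<bullet> t I \<subseteq> t (b \<bullet> I)"
    using inv_l_coset_l_coset(2)[OF b nonzero_ideal_carrier[OF tbI]] by simp
qed

text \<open>A choice of denominator, immaterial by \<open>star_extension_eq\<close> below. The zero ideal has no
  multiple among the nonzero ideals and is sent to the only possible value.\<close>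

definition star_extension :: "('a set \<Rightarrow> 'a set) \<Rightarrow> 'a set \<Rightarrow> 'a set"
  where "star_extension t = (\<lambda>I\<in>fractional_ideals D K. if I = {\<zero>} then {\<zero>} else
    let d = SOME d. d \<in> carrier K - {\<zero>} \<and> d \<bullet> I \<in> nonzero_ideals D K in inv d \<bullet> t (d \<bullet> I))"

lemma star_extension_zero: "star_extension t {\<zero>} = {\<zero>}"
  by (simp add: star_extension_def zero_fractional)

lemma star_extension_eq:
  assumes t: "t \<in> carrier (Mult D K (nonzero_ideals D K))" and I: "I \<in> fractional_ideals D K"
    and b: "b \<in> carrier K - {\<zero>}" and bI: "b \<bullet> I \<in> nonzero_ideals D K"
  shows "star_extension t I = inv b \<bullet> t (b \<bullet> I)"
proof -
  define d where "d = (SOME d. d \<in> carrier K - {\<zero>} \<and> d \<bullet> I \<in> nonzero_ideals D K)"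
  have d: "d \<in> carrier K - {\<zero>}" "d \<bullet> I \<in> nonzero_ideals D K"
    using someI[of "\<lambda>d. d \<in> carrier K - {\<zero>} \<and> d \<bullet> I \<in> nonzero_ideals D K" b] b bI
    by (auto simp: d_def)
  have nz: "I \<noteq> {\<zero>}"
    using l_coset_zero[of b] b bI by (auto simp: nonzero_ideals_iff)
  note dinv = nonzero_inv[OF d(1)] and binv = nonzero_inv[OF b]
  \<comment> \<open>The two candidates differ by the factor \<open>b / d\<close> inside and outside \<open>t\<close>.\<close>
  define c where "c = b \<otimes> inv d"
  have c: "c \<in> carrier K - {\<zero>}"
    unfolding c_def using nonzero_mult[OF b dinv(1)] .
  have cd: "c \<otimes> d = b"
    using b d dinv by (simp add: c_def m_assoc)
  have "inv b \<otimes> c = inv d"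
    using b d binv dinv by (simp add: c_def m_assoc[symmetric])
  moreover have "c \<bullet> (d \<bullet> I) = b \<bullet> I"
    using c d cd fractional_carrier[OF I] by (simp add: l_coset_l_coset)
  moreover have "t (c \<bullet> (d \<bullet> I)) = c \<bullet> t (d \<bullet> I)"
    using multiplicative_operation_scale[OF t d(2) c] bI \<open>c \<bullet> (d \<bullet> I) = b \<bullet> I\<close> by simp
  moreover have "t (d \<bullet> I) \<subseteq> carrier K"
    using t d(2) nonzero_ideal_carrier by (auto simp: mem_Mult_iff)
  ultimately have "inv d \<bullet> t (d \<bullet> I) = inv b \<bullet> t (b \<bullet> I)"
    using binv c by (simp add: l_coset_l_coset)
  then show ?thesis
    using I nz by (simp add: star_extension_def Let_def d_def)
qed

text \<open>Each axiom is transported from \<open>t\<close> by clearing a denominator of the largest fractional ideal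
  in it, which is a denominator of the smaller ones.\<close>

lemma star_extension_mem_Star:
  assumes t: "t \<in> carrier (Mult D K (nonzero_ideals D K))"
  shows "star_extension t \<in> carrier (Star D K)"
proof -
  let ?s = "star_extension t"
  have tN: "t J \<in> nonzero_ideals D K" if "J \<in> nonzero_ideals D K" for J
    using t that by (auto simp: mem_Mult_iff)
  have t_ext: "J \<subseteq> t J" and t_idem: "t (t J) = t J" if "J \<in> nonzero_ideals D K" for J
    using t that by (auto simp: mem_Mult_iff)
  have t_mono: "t J \<subseteq> t J'"
    if "J \<in> nonzero_ideals D K" "J' \<in> nonzero_ideals D K" "J \<subseteq> J'" for J J'
    using t that by (auto simp: mem_Mult_iff)

  have scaled: "d \<bullet> ?s I = t (d \<bullet> I)" "?s I \<in> fractional_ideals D K" "I \<subseteq> ?s I"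
    if I: "I \<in> fractional_ideals D K" and d: "d \<in> carrier K - {\<zero>}"
      and dI: "d \<bullet> I \<in> nonzero_ideals D K" for I d
  proof -
    have eq: "?s I = inv d \<bullet> t (d \<bullet> I)"
      by (rule star_extension_eq[OF t I d dI])
    show sc: "d \<bullet> ?s I = t (d \<bullet> I)"
      unfolding eq by (rule inv_l_coset_l_coset(2)[OF d nonzero_ideal_carrier[OF tN[OF dI]]])
    have "?s I \<in> submodules_of D K"
      unfolding eq using submodule_l_coset nonzero_inv(1)[OF d] tN[OF dI]
      by (simp add: nonzero_ideals_iff)
    moreover have "d \<bullet> ?s I \<subseteq> D"
      unfolding sc using tN[OF dI] by (simp add: nonzero_ideals_iff)
    ultimately show "?s I \<in> fractional_ideals D K"
      by (rule fractionalI[OF _ d])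
    show "I \<subseteq> ?s I"
      using l_coset_mono[OF t_ext[OF dI], where x = "inv d" and G = K] inv_l_coset_l_coset(1)[OF d fractional_carrier[OF I]]
      by (simp add: eq)
  qed

  have den: "\<exists>d. d \<in> carrier K - {\<zero>} \<and> d \<bullet> I \<subseteq> D \<and> d \<bullet> I \<in> nonzero_ideals D K"
    if I: "I \<in> fractional_ideals D K" "I \<noteq> {\<zero>}" for I
  proof -
    obtain d where d: "d \<in> carrier K - {\<zero>}" "d \<bullet> I \<subseteq> D"
      by (rule fractional_denominator[OF I(1)])
    then show ?thesis
      using denominator_nonzero_ideal[OF I d] by blast
  qed

  have closed: "?s I \<in> fractional_ideals D K" and extensive: "I \<subseteq> ?s I"
    if I: "I \<in> fractional_ideals D K" for I
  proof -
    have "?s I \<in> fractional_ideals D K \<and> I \<subseteq> ?s I"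
    proof (cases "I = {\<zero>}")
      case True
      then show ?thesis
        by (simp add: star_extension_zero zero_fractional)
    next
      case False
      then show ?thesis
        using den[OF I] scaled(2,3)[OF I] by blast
    qed
    then show "?s I \<in> fractional_ideals D K" "I \<subseteq> ?s I"
      by auto
  qed

  have mono: "?s I \<subseteq> ?s J"
    if I: "I \<in> fractional_ideals D K" and J: "J \<in> fractional_ideals D K" and le: "I \<subseteq> J" for I J
  proof (cases "I = {\<zero>}")
    case True
    then show ?thesis
      using submodule_zero[OF fractional_submodule[OF closed[OF J]]] by (simp add: star_extension_zero)
  next
    case False
    have "J \<noteq> {\<zero>}"
      using False le submodule_zero[OF fractional_submodule[OF I]] by auto
    then obtain d where d: "d \<in> carrier K - {\<zero>}" "d \<bullet> J \<subseteq> D" "d \<bullet> J \<in> nonzero_ideals D K"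
      using den[OF J] by blast
    have dIJ: "d \<bullet> I \<subseteq> d \<bullet> J"
      by (rule l_coset_mono[OF le])
    then have dI: "d \<bullet> I \<in> nonzero_ideals D K"
      using denominator_nonzero_ideal[OF I False d(1)] d(2) by blast
    show ?thesis
      using star_extension_eq[OF t I d(1) dI] star_extension_eq[OF t J d(1,3)]
        l_coset_mono[OF t_mono[OF dI d(3) dIJ]] by simp
  qed

  have idem: "?s (?s I) = ?s I" if I: "I \<in> fractional_ideals D K" for I
  proof (cases "I = {\<zero>}")
    case True
    then show ?thesis
      by (simp add: star_extension_zero)
  next
    case False
    then obtain d where d: "d \<in> carrier K - {\<zero>}" "d \<bullet> I \<in> nonzero_ideals D K"
      using den[OF I] by blast
    have sc: "d \<bullet> ?s I = t (d \<bullet> I)"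
      by (rule scaled(1)[OF I d])
    then have "?s (?s I) = inv d \<bullet> t (t (d \<bullet> I))"
      using star_extension_eq[OF t closed[OF I] d(1)] tN[OF d(2)] by simp
    then show ?thesis
      using star_extension_eq[OF t I d] t_idem[OF d(2)] by simp
  qed

  have homogeneous: "x \<bullet> ?s I = ?s (x \<bullet> I)"
    if x: "x \<in> carrier K" and I: "I \<in> fractional_ideals D K" for x I
  proof (cases "x = \<zero> \<or> I = {\<zero>}")
    case True
    then show ?thesis
      using zero_l_coset[OF fractional_submodule[OF I]] l_coset_zero[OF x]
        zero_l_coset[OF fractional_submodule[OF closed[OF I]]] by (auto simp: star_extension_zero)
  next
    case False
    then have x': "x \<in> carrier K - {\<zero>}" and nz: "I \<noteq> {\<zero>}"
      using x by auto
    obtain d where d: "d \<in> carrier K - {\<zero>}" "d \<bullet> I \<in> nonzero_ideals D K"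
      using den[OF I nz] by blast
    \<comment> \<open>\<open>d / x\<close> is a denominator of \<open>x I\<close>, with the same numerator ideal \<open>d I\<close>.\<close>
    define c where "c = d \<otimes> inv x"
    have c: "c \<in> carrier K - {\<zero>}"
      unfolding c_def by (rule nonzero_mult[OF d(1) nonzero_inv(1)[OF x']])
    have cx: "c \<otimes> x = d"
      using x' d nonzero_inv[OF x'] by (simp add: c_def m_assoc)
    have cxI: "c \<bullet> (x \<bullet> I) = d \<bullet> I"
      using c x cx fractional_carrier[OF I] by (simp add: l_coset_l_coset)
    have "c \<bullet> (x \<bullet> ?s I) = t (d \<bullet> I)"
      using scaled(1)[OF I d] c x cx fractional_carrier[OF closed[OF I]] by (simp add: l_coset_l_coset)
    moreover have "c \<bullet> ?s (x \<bullet> I) = t (d \<bullet> I)"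
      using scaled(1)[OF fractional_l_coset[OF x I] c] cxI d(2) by simp
    ultimately have "inv c \<bullet> (c \<bullet> (x \<bullet> ?s I)) = inv c \<bullet> (c \<bullet> ?s (x \<bullet> I))"
      by simp
    then show ?thesis
      using inv_l_coset_l_coset(1)[OF c] fractional_carrier fractional_l_coset[OF x closed[OF I]]
        closed[OF fractional_l_coset[OF x I]] by simp
  qed

  have "?s D = inv \<one> \<bullet> t (\<one> \<bullet> D)"
    using star_extension_eq[OF t nonzero_ideal_fractional[OF D_nonzero_ideal], of \<one>]
      one_l_coset[OF D_carrier] D_nonzero_ideal by simp
  also have "\<dots> = t D"
    using one_l_coset D_carrier nonzero_ideal_carrier[OF tN[OF D_nonzero_ideal]] by simp
  also have "\<dots> = D"
    using tN[OF D_nonzero_ideal] t_ext[OF D_nonzero_ideal] by (auto simp: nonzero_ideals_iff)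
  finally have "?s D = D" .
  moreover have "?s \<in> fractional_ideals D K \<rightarrow>\<^sub>E fractional_ideals D K"
    using closed by (auto simp: star_extension_def)
  ultimately show ?thesis
    using extensive mono idem homogeneous by (simp add: mem_Star_iff)
qed

lemma restrict_star_extension:
  assumes t: "t \<in> carrier (Mult D K (nonzero_ideals D K))"
  shows "restrict (star_extension t) (nonzero_ideals D K) = t"
proof (rule extensionalityI)
  have tN: "t \<in> nonzero_ideals D K \<rightarrow>\<^sub>E nonzero_ideals D K"
    using t[unfolded mem_Mult_iff] by (rule conjunct1)
  then show "t \<in> extensional (nonzero_ideals D K)"
    by (simp add: PiE_def)
  show "restrict (star_extension t) (nonzero_ideals D K) I = t I" if I: "I \<in> nonzero_ideals D K" for I
  proof -
    have "t I \<in> nonzero_ideals D K"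
      using tN I by (rule PiE_mem)
    then show ?thesis
      using star_extension_eq[OF t nonzero_ideal_fractional[OF I], of \<one>] I
        one_l_coset nonzero_ideal_carrier by simp
  qed
qed simp

end


section \<open>The order isomorphism\<close>

theorem proposition3p4:
  fixes D :: "'a set" and K :: "('a, 'm) ring_scheme"
  assumes "quotient_field D K"
  shows "order_isomorphism (Star D K) (Mult D K (nonzero_ideals D K))
    (\<lambda>s. restrict s (nonzero_ideals D K))"
proof -
  interpret quotient_field D K
    by (rule assms)
  show ?thesis
    unfolding Star_def Mult_def
  proof (rule order_isomorphism_operation_posetI, fold Star_def Mult_def)
    show "restrict s (nonzero_ideals D K) \<in> carrier (Mult D K (nonzero_ideals D K))"
      if "s \<in> carrier (Star D K)" for s
      using that by (rule star_operation_restrict)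
    show "(\<forall>I\<in>nonzero_ideals D K.
        restrict s (nonzero_ideals D K) I \<subseteq> restrict t (nonzero_ideals D K) I) \<longleftrightarrow>
        (\<forall>I\<in>fractional_ideals D K. s I \<subseteq> t I)"
      if "s \<in> carrier (Star D K)" "t \<in> carrier (Star D K)" for s t
      using star_operations_le_iff[OF that] by simp
    show "\<exists>s\<in>carrier (Star D K). restrict s (nonzero_ideals D K) = t"
      if "t \<in> carrier (Mult D K (nonzero_ideals D K))" for t
      using star_extension_mem_Star[OF that] restrict_star_extension[OF that] by blast
  qed
qed

end
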